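(* Let $\tilde\alpha,\tilde\beta\in\mathbb{Z}$, let $\tau_1=\pm1$, $\tau_2=\pm1$, and let $\tau_3,\tau_4,\tau_5$ be non-zero integers. Let $(\tau_n)_{n\in\mathbb{Z}}$ be the Somos 5 sequence defined by $$\tau_{n+3}\tau_{n-2}=\tilde\alpha\,\tau_{n+2}\tau_{n-1}+\tilde\beta\,\tau_{n+1}\tau_n$$ with initial values $\tau_1,\dots,\tau_5$, and put $$\tilde J=\frac{\tau_4\tau_1}{\tau_3\tau_2}+\frac{\tau_5\tau_2}{\tau_4\tau_3}+\tilde\alpha\left(\frac{\tau_3\tau_2}{\tau_4\tau_1}+\frac{\tau_4\tau_3}{\tau_5\tau_2}\right)+\tilde\beta\,\frac{(\tau_3)^2}{\tau_5\tau_1}.$$ If $\tilde\alpha\tilde J\in\mathbb{Z}$, then $\tau_n\in\mathbb{Z}$ for all $n\ge1$. If, furthermore, the backward iterates $\tau_0,\tau_{-1},\tau_{-2}$ are integers, then $\tau_n\in\mathbb{Z}$ for all $n\in\mathbb{Z}$.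
   Context: The recurrence is iterated forwards and backwards from the five non-zero values $\tau_1,\dots,\tau_5$, giving a sequence indexed by $\mathbb{Z}$. Convention on zeros: if a zero term is encountered, the sequence is analytically continued through it. That is, $\tau_n$ is by definition the value at the given data of the rational function of $\tilde\alpha,\tilde\beta,\tau_1,\dots,\tau_5$ obtained by iterating the recurrence formally with these quantities as indeterminates; it is known (the Laurent property of Fomin and Zelevinsky) that this rational function lies in $\mathbb{Z}[\tilde\alpha,\tilde\beta,\tau_1^{\pm1},\dots,\tau_5^{\pm1}]$, so its value is well defined whenever $\tau_1,\dots,\tau_5$ are non-zero. *)

theory Defs
  imports Complex_Main "HOL-Library.Poly_Mapping" "HOL-Computational_Algebra.Fraction_Field"
begin

text \<open>
  Integer polynomials in indeterminates indexed by natural numbers: a monomial is a finitely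
  supported map from indeterminates to exponents, a polynomial a finitely supported map from
  monomials to coefficients. Elements of \<open>int_mpoly fract\<close> are the rational functions.
\<close>

type_synonym int_mpoly = "(nat \<Rightarrow>\<^sub>0 nat) \<Rightarrow>\<^sub>0 int"

definition indet :: "nat \<Rightarrow> int_mpoly fract"
  where "indet i = Fract (Poly_Mapping.single (Poly_Mapping.single i 1) 1) 1"

definition eval_monom :: "(nat \<Rightarrow> 'a::comm_ring_1) \<Rightarrow> (nat \<Rightarrow>\<^sub>0 nat) \<Rightarrow> 'a"
  where "eval_monom x m = (\<Prod>i\<in>Poly_Mapping.keys m. x i ^ Poly_Mapping.lookup m i)"

definition eval_mpoly :: "(nat \<Rightarrow> 'a::comm_ring_1) \<Rightarrow> int_mpoly \<Rightarrow> 'a"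
  where "eval_mpoly x P =
    (\<Sum>m\<in>Poly_Mapping.keys P. of_int (Poly_Mapping.lookup P m) * eval_monom x m)"

text \<open>
  The value at the point \<open>x\<close> of a rational function is read off from any representation as a
  quotient whose denominator does not vanish at \<open>x\<close>; by \<open>fract_value_eqI\<close> below it does not
  depend on the representation. If there is no such representation, it is unspecified.
\<close>

definition fract_value :: "(nat \<Rightarrow> 'a::field) \<Rightarrow> int_mpoly fract \<Rightarrow> 'a"
  where "fract_value x f = (THE v. \<exists>P Q. f = Fract P Q \<and> eval_mpoly x Q \<noteq> 0 \<and>
    v = eval_mpoly x P / eval_mpoly x Q)"

text \<open>
  The formal Somos 5 sequence: \<open>indet 1\<close>, \dots, \<open>indet 5\<close> stand for the initial values, and
  \<open>indet 6\<close>, \<open>indet 7\<close> for the two coefficients of the recurrence.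
\<close>

function somos5_formal :: "int \<Rightarrow> int_mpoly fract" where
  "somos5_formal n =
    (if 1 \<le> n \<and> n \<le> 5 then indet (nat n)
     else if 5 < n then
       (indet 6 * somos5_formal (n - 1) * somos5_formal (n - 4)
        + indet 7 * somos5_formal (n - 2) * somos5_formal (n - 3)) / somos5_formal (n - 5)
     else
       (indet 6 * somos5_formal (n + 4) * somos5_formal (n + 1)
        + indet 7 * somos5_formal (n + 3) * somos5_formal (n + 2)) / somos5_formal (n + 5))"
  by auto
termination by (relation "measure (\<lambda>n. nat \<bar>n - 3\<bar>)") auto

declare somos5_formal.simps [simp del]

definition somos5 :: "'a::field \<Rightarrow> 'a \<Rightarrow> 'a \<Rightarrow> 'a \<Rightarrow> 'a \<Rightarrow> 'a \<Rightarrow> 'a \<Rightarrow> int \<Rightarrow> 'a"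
  where "somos5 \<alpha> \<beta> t1 t2 t3 t4 t5 n =
    fract_value (\<lambda>i. [0, t1, t2, t3, t4, t5, \<alpha>, \<beta>] ! i) (somos5_formal n)"

definition somos5_J :: "'a::field \<Rightarrow> 'a \<Rightarrow> 'a \<Rightarrow> 'a \<Rightarrow> 'a \<Rightarrow> 'a \<Rightarrow> 'a \<Rightarrow> 'a"
  where "somos5_J \<alpha> \<beta> t1 t2 t3 t4 t5 =
    t4 * t1 / (t3 * t2) + t5 * t2 / (t4 * t3)
    + \<alpha> * (t3 * t2 / (t4 * t1) + t4 * t3 / (t5 * t2))
    + \<beta> * (t3 ^ 2 / (t5 * t1))"

lemma eval_monom_add: "eval_monom x (m + n) = eval_monom x m * eval_monom x n"
proof -
  have *: "eval_monom x k = (\<Prod>i\<in>Poly_Mapping.keys m \<union> Poly_Mapping.keys n. x i ^ Poly_Mapping.lookup k i)"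
    if "Poly_Mapping.keys k \<subseteq> Poly_Mapping.keys m \<union> Poly_Mapping.keys n" for k
    unfolding eval_monom_def by (rule prod.mono_neutral_left) (use that in \<open>auto simp: in_keys_iff\<close>)
  show ?thesis
    by (simp add: * Poly_Mapping.keys_add lookup_add power_add prod.distrib)
qed

lemma eval_mpoly_superset:
  assumes "finite S" "Poly_Mapping.keys P \<subseteq> S"
  shows "eval_mpoly x P = (\<Sum>m\<in>S. of_int (Poly_Mapping.lookup P m) * eval_monom x m)"
  unfolding eval_mpoly_def by (rule sum.mono_neutral_left) (use assms in \<open>auto simp: in_keys_iff\<close>)

lemma eval_mpoly_add: "eval_mpoly x (P + Q) = eval_mpoly x P + eval_mpoly x Q"
proof -
  have "finite (Poly_Mapping.keys P \<union> Poly_Mapping.keys Q)" by simp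
  note * = eval_mpoly_superset[OF this]
  show ?thesis
    by (simp add: * Poly_Mapping.keys_add lookup_add ring_distribs sum.distrib)
qed

lemma eval_mpoly_0: "eval_mpoly x 0 = 0"
  by (simp add: eval_mpoly_def)

lemma eval_mpoly_single: "eval_mpoly x (Poly_Mapping.single m c) = of_int c * eval_monom x m"
  by (simp add: eval_mpoly_def)

lemma mpoly_eq_sum: "P = (\<Sum>m\<in>Poly_Mapping.keys P. Poly_Mapping.single m (Poly_Mapping.lookup P m))"
  for P :: int_mpoly
  by (rule poly_mapping_eqI)
    (auto simp: lookup_sum lookup_single when_def in_keys_iff sum.delta)

lemma eval_mpoly_sum: "eval_mpoly x (sum f A) = (\<Sum>a\<in>A. eval_mpoly x (f a))"
  by (induction A rule: infinite_finite_induct) (auto simp: eval_mpoly_0 eval_mpoly_add)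

lemma eval_mpoly_mult: "eval_mpoly x (P * Q) = eval_mpoly x P * eval_mpoly x Q"
proof -
  have "P * Q = (\<Sum>m\<in>Poly_Mapping.keys P. \<Sum>n\<in>Poly_Mapping.keys Q. Poly_Mapping.single (m + n) (Poly_Mapping.lookup P m * Poly_Mapping.lookup Q n))"
    by (subst mpoly_eq_sum[of P], subst mpoly_eq_sum[of Q])
      (simp add: sum_product mult_single)
  hence "eval_mpoly x (P * Q) = (\<Sum>m\<in>Poly_Mapping.keys P. \<Sum>n\<in>Poly_Mapping.keys Q.
      (of_int (Poly_Mapping.lookup P m) * eval_monom x m) * (of_int (Poly_Mapping.lookup Q n) * eval_monom x n))"
    by (simp add: eval_mpoly_sum eval_mpoly_single eval_monom_add mult_ac)
  thus ?thesis by (simp add: eval_mpoly_def sum_product)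
qed

lemma fract_value_eqI:
  assumes "eval_mpoly x Q \<noteq> 0"
  shows "fract_value x (Fract P Q) = eval_mpoly x P / eval_mpoly x Q"
  unfolding fract_value_def
proof (rule the_equality)
  fix v assume "\<exists>P' Q'. Fract P Q = Fract P' Q' \<and> eval_mpoly x Q' \<noteq> 0 \<and>
      v = eval_mpoly x P' / eval_mpoly x Q'"
  then obtain P' Q' where *: "Fract P Q = Fract P' Q'" "eval_mpoly x Q' \<noteq> 0"
      "v = eval_mpoly x P' / eval_mpoly x Q'" by blast
  have "Q \<noteq> 0" "Q' \<noteq> 0" using assms * by (auto simp: eval_mpoly_0)
  hence "P * Q' = P' * Q" using * by (simp add: eq_fract)
  hence "eval_mpoly x P * eval_mpoly x Q' = eval_mpoly x P' * eval_mpoly x Q"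
    by (metis eval_mpoly_mult)
  thus "v = eval_mpoly x P / eval_mpoly x Q"
    unfolding *(3) using assms *(2) by (simp add: frac_eq_eq)
qed (use assms in blast)

lemma somos5_initial:
  "somos5 \<alpha> \<beta> t1 t2 t3 t4 t5 1 = t1" "somos5 \<alpha> \<beta> t1 t2 t3 t4 t5 2 = t2"
  "somos5 \<alpha> \<beta> t1 t2 t3 t4 t5 3 = t3" "somos5 \<alpha> \<beta> t1 t2 t3 t4 t5 4 = t4"
  "somos5 \<alpha> \<beta> t1 t2 t3 t4 t5 5 = t5"
proof -
  have "eval_mpoly x 1 = 1" for x :: "nat \<Rightarrow> 'a"
    by (simp add: eval_mpoly_single eval_monom_def flip: single_one)
  hence "fract_value x (indet i) = x i" for x :: "nat \<Rightarrow> 'a" and i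
    by (simp add: indet_def fract_value_eqI eval_mpoly_single eval_monom_def)
  thus "somos5 \<alpha> \<beta> t1 t2 t3 t4 t5 1 = t1" "somos5 \<alpha> \<beta> t1 t2 t3 t4 t5 2 = t2"
    "somos5 \<alpha> \<beta> t1 t2 t3 t4 t5 3 = t3" "somos5 \<alpha> \<beta> t1 t2 t3 t4 t5 4 = t4"
    "somos5 \<alpha> \<beta> t1 t2 t3 t4 t5 5 = t5"
    by (simp_all add: somos5_def somos5_formal.simps nth_Cons')
qed

end

theory Submission
  imports Defs
begin

text \<open>
  The idea is that of elliptic divisibility sequences. Along a Somos 5 sequence \<open>s\<close> the quantity
  \<open>J = somos5_J\<close> is conserved. To \<open>\<alpha>\<close>, \<open>\<beta>\<close>, \<open>J\<close> belongs a companion sequence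
  \<open>a = 0, 1, 1, \<alpha>, -\<beta>, \<dots>\<close>, itself a Somos 5 sequence with the same invariant, such that
  \<open>s (p+2*k+3) * s p = a (k+1) * a (k+2) * s (p+k+3) * s (p+k) - a (k+3) * a k * s (p+k+2) * s (p+k+1)\<close>
  for all \<open>p\<close> and \<open>k\<close> (\<open>somos5_addition\<close>). The point of this formula is that \<open>p\<close> may stay fixed
  while \<open>k\<close> grows: an arbitrarily late term is obtained by dividing only by \<open>s\<^sub>0\<close> or, according to
  the parity of its index, by \<open>s\<^sub>1\<close>. These are invertible when they are \<open>\<plusminus>1\<close>.

  It remains to see that the coefficients are integral. The formula also applies to \<open>s = a\<close>, where
  the two divisors are \<open>a\<^sub>1 = a\<^sub>2 = 1\<close>. So it becomes a division-free recursion, and all \<open>a\<^sub>n\<close> are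
  integer polynomials in \<open>\<alpha>\<close>, \<open>\<beta>\<close> and \<open>\<alpha> * J\<close>, because the initial values are; the last one is
  \<open>a\<^sub>5 = -(\<beta> * (\<beta> + \<alpha> * J) + \<alpha>^3)\<close>.

  Numerical terms of the sequences can vanish, which would spoil the divisions in this argument.
  It is therefore carried out in the field of rational functions, for the subring of those
  functions that take an integer value at the given point; no term vanishes there, because
  a suitable specialization makes all terms of both sequences positive, apart from \<open>a\<^sub>0 = 0\<close>. The backward half is the
  forward half for the reversed sequence, whose first two terms are \<open>\<tau>\<^sub>2\<close> and \<open>\<tau>\<^sub>1\<close>.
\<close>

section \<open>The invariant of a Somos 5 sequence\<close>

lemma somos5_J_reverse: "somos5_J \<alpha> \<beta> t5 t4 t3 t2 t1 = somos5_J \<alpha> \<beta> t1 t2 t3 t4 t5"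
  by (simp add: somos5_J_def algebra_simps)

text \<open>
  With \<open>u\<^sub>i = x\<^sub>i\<^sub>+\<^sub>2 x\<^sub>i\<^sub>-\<^sub>1 / (x\<^sub>i\<^sub>+\<^sub>1 x\<^sub>i)\<close>, the recurrence reads \<open>u\<^sub>1 u\<^sub>2 u\<^sub>3 = \<alpha> u\<^sub>2 + \<beta>\<close>, and it turns
  the five-term expression for \<open>J\<close> into \<open>u\<^sub>1 + u\<^sub>2 + u\<^sub>3 + \<alpha> / u\<^sub>2\<close>. Clearing denominators makes
  this a polynomial relation that also makes sense when terms vanish, and that is symmetric under
  reversal of the six terms, whence the conservation of \<open>J\<close>.
\<close>

lemma somos5_J_window:
  fixes x0 x1 x2 x3 x4 x5 :: "'a::field"
  assumes nz: "x0 \<noteq> 0" "x1 \<noteq> 0" "x2 \<noteq> 0" "x3 \<noteq> 0" "x4 \<noteq> 0"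
    and rec: "x5 * x0 = \<alpha> * x4 * x1 + \<beta> * x3 * x2"
  shows "somos5_J \<alpha> \<beta> x0 x1 x2 x3 x4 * (x1 * x2 * x3 * x4) =
    x3^2 * x0 * x4 + x4^2 * x1^2 + x5 * x2^2 * x1 + \<alpha> * x2^2 * x3^2"
proof -
  have x5: "x5 = (\<alpha> * x4 * x1 + \<beta> * x3 * x2) / x0"
    using rec nz by (simp add: field_simps)
  show ?thesis
    unfolding somos5_J_def x5 using nz
    by (simp add: divide_simps) (simp add: algebra_simps power2_eq_square)
qed

lemma somos5_J_step:
  fixes x0 x1 x2 x3 x4 x5 :: "'a::field"
  assumes nz: "x0 \<noteq> 0" "x1 \<noteq> 0" "x2 \<noteq> 0" "x3 \<noteq> 0" "x4 \<noteq> 0" "x5 \<noteq> 0"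
    and rec: "x5 * x0 = \<alpha> * x4 * x1 + \<beta> * x3 * x2"
  shows "somos5_J \<alpha> \<beta> x1 x2 x3 x4 x5 = somos5_J \<alpha> \<beta> x0 x1 x2 x3 x4"
proof -
  have "somos5_J \<alpha> \<beta> x5 x4 x3 x2 x1 * (x4 * x3 * x2 * x1) =
      x2^2 * x5 * x1 + x1^2 * x4^2 + x0 * x3^2 * x4 + \<alpha> * x3^2 * x2^2"
    by (rule somos5_J_window) (use assms in \<open>auto simp: algebra_simps\<close>)
  also have "\<dots> = somos5_J \<alpha> \<beta> x0 x1 x2 x3 x4 * (x1 * x2 * x3 * x4)"
    by (subst somos5_J_window[OF nz(1-5) rec]) (simp add: algebra_simps)
  finally have "somos5_J \<alpha> \<beta> x1 x2 x3 x4 x5 * (x1 * x2 * x3 * x4) =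
      somos5_J \<alpha> \<beta> x0 x1 x2 x3 x4 * (x1 * x2 * x3 * x4)"
    by (simp add: somos5_J_reverse mult_ac)
  thus ?thesis using nz by simp
qed

text \<open>
  The recurrence together with the denominator-free form of the invariant, on six consecutive terms.
  Unlike \<open>somos5_J\<close>, it does not degenerate at the zero term of the companion sequence.
\<close>

definition somos5_window :: "'a::field \<Rightarrow> 'a \<Rightarrow> 'a \<Rightarrow> (nat \<Rightarrow> 'a) \<Rightarrow> nat \<Rightarrow> bool"
  where "somos5_window \<alpha> \<beta> J s n \<longleftrightarrow>
    s (n+5) * s n = \<alpha> * s (n+4) * s (n+1) + \<beta> * s (n+3) * s (n+2) \<and>
    J * (s (n+1) * s (n+2) * s (n+3) * s (n+4)) =
      s (n+3)^2 * s n * s (n+4) + s (n+4)^2 * s (n+1)^2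
        + s (n+5) * s (n+2)^2 * s (n+1) + \<alpha> * s (n+2)^2 * s (n+3)^2"

lemma somos5_J_const:
  fixes s :: "nat \<Rightarrow> 'a::field"
  assumes nz: "\<And>n. s n \<noteq> 0"
    and rec: "\<And>n. s (n+5) * s n = \<alpha> * s (n+4) * s (n+1) + \<beta> * s (n+3) * s (n+2)"
  shows "somos5_J \<alpha> \<beta> (s n) (s (n+1)) (s (n+2)) (s (n+3)) (s (n+4)) =
    somos5_J \<alpha> \<beta> (s 0) (s 1) (s 2) (s 3) (s 4)"
proof (induction n)
  case 0
  show ?case by (simp add: numeral_2_eq_2)
next
  case (Suc n)
  from somos5_J_step[OF nz nz nz nz nz nz rec[of n]] Suc
  show ?case by (simp add: eval_nat_numeral)
qed

lemma somos5_windowI: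
  fixes s :: "nat \<Rightarrow> 'a::field"
  assumes nz: "\<And>n. s n \<noteq> 0"
    and rec: "\<And>n. s (n+5) * s n = \<alpha> * s (n+4) * s (n+1) + \<beta> * s (n+3) * s (n+2)"
    and J: "somos5_J \<alpha> \<beta> (s 0) (s 1) (s 2) (s 3) (s 4) = J"
  shows "somos5_window \<alpha> \<beta> J s n"
  using somos5_J_window[OF nz nz nz nz nz rec[of n]] somos5_J_const[OF nz rec, of n] rec[of n] J
  by (simp add: somos5_window_def)

section \<open>The addition formula\<close>

text \<open>
  Write \<open>F\<^sub>k(p)\<close> for the left-hand side. As a product of four terms,
  \<open>F\<^sub>k\<^sub>+\<^sub>2(p) F\<^sub>k(p + 2) = F\<^sub>k\<^sub>+\<^sub>1(p) F\<^sub>k\<^sub>+\<^sub>1(p + 2)\<close>, so the formula for \<open>k + 2\<close> follows from those for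
  \<open>k\<close> and \<open>k + 1\<close> if the right-hand sides satisfy the same relation. Both sides of that relation
  are quadratic forms in the products \<open>x\<^sub>4 x\<^sub>1\<close> and \<open>x\<^sub>3 x\<^sub>2\<close> of the inner terms of the window
  \<open>x\<^sub>i = s (p + k + 1 + i)\<close>, once the outer terms \<open>x\<^sub>0\<close> and \<open>x\<^sub>5\<close> are eliminated by the recurrence and the invariant of \<open>s\<close>. Comparing coefficients leaves
  three identities: one is trivial, and the other two are the recurrence and the invariant of \<open>a\<close>.
\<close>

lemma somos5_addition:
  fixes s a :: "nat \<Rightarrow> 'a::field"
  assumes nz: "\<And>n. s n \<noteq> 0"
    and s: "\<And>n. somos5_window \<alpha> \<beta> J s n"
    and a: "\<And>n. somos5_window \<alpha> \<beta> J a n"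
    and init: "a 0 = 0" "a 1 = 1" "a 2 = 1" "a 3 = \<alpha>" "a 4 = -\<beta>"
  shows "s (p+2*k+3) * s p =
    a (k+1) * a (k+2) * s (p+k+3) * s (p+k) - a (k+3) * a k * s (p+k+2) * s (p+k+1)"
proof (induction k arbitrary: p rule: induct_nat_012)
  case 0
  show ?case using init by (simp add: numeral_2_eq_2)
next
  case 1
  show ?case using s[of p] init
    by (simp add: somos5_window_def eval_nat_numeral algebra_simps)
next
  case (ge2 k)
  \<comment> \<open>The three pairs are the coefficients of the right-hand sides for \<open>k + 1\<close>, \<open>k + 2\<close> and \<open>k\<close>.\<close>
  define A B where "A = a (k+2) * a (k+3)" and "B = - (a (k+4) * a (k+1))"
  define A' B' where "A' = a (k+3) * a (k+4)" and "B' = - (a (k+5) * a (k+2))"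
  define A'' B'' where "A'' = a (k+1) * a (k+2)" and "B'' = - (a (k+3) * a k)"
  define x where "x i = s (p+k+1+i)" for i
  have AA: "A' * A'' = - (A * B)"
    by (simp add: A_def B_def A'_def A''_def)
  have "B' * B'' = a (k+2) * a (k+3) * (a (k+5) * a k)"
    by (simp add: B'_def B''_def)
  also have "a (k+5) * a k = \<alpha> * a (k+4) * a (k+1) + \<beta> * a (k+3) * a (k+2)"
    using a[of k] by (simp add: somos5_window_def)
  finally have BB: "B' * B'' = A^2 * \<beta> - A * B * \<alpha>"
    by (simp add: A_def B_def algebra_simps power2_eq_square)
  have "J * (a (k+1) * a (k+2) * a (k+3) * a (k+4)) =
      a (k+3)^2 * a k * a (k+4) + a (k+4)^2 * a (k+1)^2
        + a (k+5) * a (k+2)^2 * a (k+1) + \<alpha> * a (k+2)^2 * a (k+3)^2"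
    using a[of k] by (simp add: somos5_window_def)
  hence AB: "A' * B'' + B' * A'' = A^2 * \<alpha> + A * B * J + B^2"
    unfolding A_def B_def A'_def B'_def A''_def B''_def by algebra
  have xrec: "x 5 * x 0 = \<alpha> * x 4 * x 1 + \<beta> * x 3 * x 2"
    and xJ: "J * (x 1 * x 2 * x 3 * x 4) =
      x 3^2 * x 0 * x 4 + x 4^2 * x 1^2 + x 5 * x 2^2 * x 1 + \<alpha> * x 2^2 * x 3^2"
    using s[of "p+k+1"] by (simp_all add: somos5_window_def x_def add.assoc)
  have prod: "(A * x 3 * x 0 + B * x 2 * x 1) * (A * x 5 * x 2 + B * x 4 * x 3) =
      (A' * x 4 * x 1 + B' * x 3 * x 2) * (A'' * x 4 * x 1 + B'' * x 3 * x 2)"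
  proof -
    have "(A * x 3 * x 0 + B * x 2 * x 1) * (A * x 5 * x 2 + B * x 4 * x 3) =
        A^2 * (x 2 * x 3) * (x 5 * x 0) + A * B * (x 3^2 * x 0 * x 4 + x 5 * x 2^2 * x 1)
          + B^2 * (x 1 * x 2 * x 3 * x 4)"
      by (simp add: algebra_simps power2_eq_square)
    also have "x 3^2 * x 0 * x 4 + x 5 * x 2^2 * x 1 =
        J * (x 1 * x 2 * x 3 * x 4) - x 4^2 * x 1^2 - \<alpha> * x 2^2 * x 3^2"
      unfolding xJ by simp
    also note xrec
    also have "A^2 * (x 2 * x 3) * (\<alpha> * x 4 * x 1 + \<beta> * x 3 * x 2)
        + A * B * (J * (x 1 * x 2 * x 3 * x 4) - x 4^2 * x 1^2 - \<alpha> * x 2^2 * x 3^2)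
        + B^2 * (x 1 * x 2 * x 3 * x 4) =
        - (A * B) * (x 4 * x 1)^2 + (A^2 * \<alpha> + A * B * J + B^2) * (x 1 * x 2 * x 3 * x 4)
          + (A^2 * \<beta> - A * B * \<alpha>) * (x 3 * x 2)^2"
      by (simp add: algebra_simps power2_eq_square)
    also have "\<dots> = (A' * x 4 * x 1 + B' * x 3 * x 2) * (A'' * x 4 * x 1 + B'' * x 3 * x 2)"
      unfolding AA[symmetric] AB[symmetric] BB[symmetric]
      by (simp add: algebra_simps power2_eq_square)
    finally show ?thesis .
  qed
  have L0: "s (p+2*k+5) * s (p+2) = A'' * x 4 * x 1 + B'' * x 3 * x 2"
    using ge2(1)[of "p+2"] by (simp add: A''_def B''_def x_def eval_nat_numeral)
  have L1: "s (p+2*k+5) * s p = A * x 3 * x 0 + B * x 2 * x 1"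
    using ge2(2)[of p] by (simp add: A_def B_def x_def eval_nat_numeral)
  have L2: "s (p+2*k+7) * s (p+2) = A * x 5 * x 2 + B * x 4 * x 3"
    using ge2(2)[of "p+2"] by (simp add: A_def B_def x_def eval_nat_numeral)
  have "(s (p+2*k+7) * s p) * (s (p+2*k+5) * s (p+2)) =
      (A' * x 4 * x 1 + B' * x 3 * x 2) * (s (p+2*k+5) * s (p+2))"
    unfolding prod[symmetric, folded L0 L1 L2] by (simp add: mult_ac)
  hence "s (p+2*k+7) * s p = A' * x 4 * x 1 + B' * x 3 * x 2"
    using nz by simp
  thus ?case by (simp add: A'_def B'_def x_def eval_nat_numeral)
qed

section \<open>The companion sequence\<close>

text \<open>
  The value at 5 is the one that gives the sequence from 1 onwards the invariant \<open>J\<close>. Up to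
  normalization the terms are the division polynomials of an elliptic curve; \<open>\<beta> + \<alpha> * J\<close> is the
  fourth power of the second one.
\<close>

function companion :: "'a::field \<Rightarrow> 'a \<Rightarrow> 'a \<Rightarrow> nat \<Rightarrow> 'a" where
  "companion \<alpha> \<beta> J n =
    (if n < 6 then [0, 1, 1, \<alpha>, -\<beta>, -(\<beta> * (\<beta> + \<alpha> * J) + \<alpha>^3)] ! n
     else (\<alpha> * companion \<alpha> \<beta> J (n - 1) * companion \<alpha> \<beta> J (n - 4)
       + \<beta> * companion \<alpha> \<beta> J (n - 2) * companion \<alpha> \<beta> J (n - 3)) / companion \<alpha> \<beta> J (n - 5))"
  by auto
termination by (relation "measure (\<lambda>(_, _, _, n). n)") auto

declare companion.simps [simp del]

lemma companion_init:
  "companion \<alpha> \<beta> J 0 = 0" "companion \<alpha> \<beta> J 1 = 1" "companion \<alpha> \<beta> J 2 = 1"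
  "companion \<alpha> \<beta> J 3 = \<alpha>" "companion \<alpha> \<beta> J 4 = -\<beta>"
  "companion \<alpha> \<beta> J 5 = -(\<beta> * (\<beta> + \<alpha> * J) + \<alpha>^3)"
  by (subst companion.simps, simp add: eval_nat_numeral)+

lemma companion_init_Suc: "companion \<alpha> \<beta> J (Suc 0) = 1" "companion \<alpha> \<beta> J (Suc (Suc 0)) = 1"
  using companion_init(2,3)[of \<alpha> \<beta> J] by (simp_all add: numeral_2_eq_2)

text \<open>
  At index 0, where the division by the first term is impossible, both identities hold by the choice
  of the initial values; from 1 onwards the terms are non-zero and the general argument applies.
\<close>

lemma companion_window:
  assumes nz: "\<And>n. companion \<alpha> \<beta> J (Suc n) \<noteq> 0"
  shows "somos5_window \<alpha> \<beta> J (companion \<alpha> \<beta> J) n"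
proof (cases n)
  case 0
  show ?thesis unfolding 0 somos5_window_def
    by (simp add: companion_init companion_init_Suc algebra_simps power2_eq_square power3_eq_cube)
next
  case (Suc m)
  let ?a = "\<lambda>n. companion \<alpha> \<beta> J (Suc n)"
  have rec: "?a (n+5) * ?a n = \<alpha> * ?a (n+4) * ?a (n+1) + \<beta> * ?a (n+3) * ?a (n+2)" for n
    using nz[of n] by (subst companion.simps) (simp add: eval_nat_numeral)
  have "\<alpha> \<noteq> 0" "\<beta> \<noteq> 0" "\<beta> * (\<beta> + \<alpha> * J) + \<alpha>^3 \<noteq> 0"
    using nz[of 2] nz[of 3] nz[of 4] by (simp_all add: companion_init minus_equation_iff[of "_ * _"] eq_neg_iff_add_eq_0 neg_eq_iff_add_eq_0)
  moreover have "somos5_J \<alpha> \<beta> 1 1 \<alpha> (-\<beta>) (-g) = (g - \<alpha>^3 - \<beta>^2) / (\<alpha> * \<beta>)"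
    if "\<alpha> \<noteq> 0" "\<beta> \<noteq> 0" "g \<noteq> 0" for g
    unfolding somos5_J_def using that
    by (simp add: field_simps power2_eq_square power3_eq_cube)
  moreover have "\<beta> * (\<beta> + \<alpha> * J) + \<alpha>^3 - \<alpha>^3 - \<beta>^2 = J * (\<alpha> * \<beta>)"
    by (simp add: algebra_simps power2_eq_square)
  ultimately have "somos5_J \<alpha> \<beta> 1 1 \<alpha> (-\<beta>) (-(\<beta> * (\<beta> + \<alpha> * J) + \<alpha>^3)) = J"
    by (simp del: minus_add_distrib)
  hence "somos5_J \<alpha> \<beta> (?a 0) (?a 1) (?a 2) (?a 3) (?a 4) = J"
    by (simp add: companion_init companion_init_Suc flip: numeral_2_eq_2)
  from somos5_windowI[OF nz rec this, of m]
  show ?thesis by (simp add: Suc somos5_window_def)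
qed

section \<open>Integrality over a subring\<close>

text \<open>
  The addition formula for the companion sequence itself, shifted by one and taken at \<open>p = 0\<close> and
  \<open>p = 1\<close>, gives duplication formulas that involve no division, since \<open>a\<^sub>1 = a\<^sub>2 = 1\<close>.
\<close>

lemma companion_in_subring:
  assumes nz: "\<And>n. companion \<alpha> \<beta> J (Suc n) \<noteq> 0"
    and diff: "\<And>x y. x \<in> R \<Longrightarrow> y \<in> R \<Longrightarrow> x - y \<in> R"
    and mult: "\<And>x y. x \<in> R \<Longrightarrow> y \<in> R \<Longrightarrow> x * y \<in> R"
    and R: "1 \<in> R" "\<alpha> \<in> R" "\<beta> \<in> R" "\<alpha> * J \<in> R"
  shows "companion \<alpha> \<beta> J n \<in> R"
proof (induction n rule: less_induct)
  case (less n)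
  let ?a = "companion \<alpha> \<beta> J"
  have "0 \<in> R" using diff[OF R(1) R(1)] by simp
  hence uminus: "x \<in> R \<Longrightarrow> - x \<in> R" for x using diff[of 0 x] by simp
  hence add: "x \<in> R \<Longrightarrow> y \<in> R \<Longrightarrow> x + y \<in> R" for x y using diff[of x "- y"] by simp
  have double: "?a (p + 2*k + 4) * ?a (p + 1) =
      ?a (k+1) * ?a (k+2) * ?a (p+k+4) * ?a (p+k+1) - ?a (k+3) * ?a k * ?a (p+k+3) * ?a (p+k+2)" for p k
    using somos5_addition[of "\<lambda>n. ?a (Suc n)", OF nz _ companion_window[OF nz] companion_init(1-5), of p k]
      companion_window[OF nz, of "Suc _"]
    by (simp add: somos5_window_def eval_nat_numeral)
  consider "n < 6" | k where "n = 2*k+4" "k \<ge> 1" | k where "n = 2*k+5" "k \<ge> 1"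
  proof (cases "n < 6")
    case False
    show ?thesis
    proof (cases "even n")
      case True
      then obtain k where "n = 2*k" by auto
      thus ?thesis using False that(2)[of "k-2"] by auto
    next
      case odd: False
      then obtain k where "n = 2*k+1" by (auto elim: oddE)
      thus ?thesis using False that(3)[of "k-2"] by auto
    qed
  qed (use that in auto)
  thus ?case
  proof cases
    case 1
    hence "n \<in> {0,1,2,3,4,5}" by auto
    moreover have "\<alpha>^3 \<in> R" using R mult by (simp add: power3_eq_cube)
    ultimately show ?thesis using R \<open>0 \<in> R\<close> mult add uminus
      by (auto simp: companion_init companion_init_Suc simp del: minus_add_distrib)
  next
    case (2 k)
    have "?a n = ?a (k+1) * ?a (k+2) * ?a (k+4) * ?a (k+1) - ?a (k+3) * ?a k * ?a (k+3) * ?a (k+2)"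
      using double[of 0 k] 2 by (simp add: companion_init companion_init_Suc)
    also have "\<dots> \<in> R" by (intro diff mult less) (use 2 in auto)
    finally show ?thesis .
  next
    case (3 k)
    have "?a n = ?a (k+1) * ?a (k+2) * ?a (k+5) * ?a (k+2) - ?a (k+3) * ?a k * ?a (k+4) * ?a (k+3)"
      using double[of 1 k] 3 by (simp add: companion_init_Suc eval_nat_numeral)
    also have "\<dots> \<in> R" by (intro diff mult less) (use 3 in auto)
    finally show ?thesis .
  qed
qed

text \<open>
  Every index from 5 onwards is \<open>2 * k + 3\<close> or \<open>2 * k + 4\<close> with \<open>k \<ge> 1\<close>; the addition formula at
  \<open>p = 0\<close> or \<open>p = 1\<close> then expresses the term by earlier ones, up to the factor \<open>s 0\<close> or \<open>s 1\<close>.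
\<close>

lemma somos5_in_subring:
  assumes anz: "\<And>n. companion \<alpha> \<beta> J (Suc n) \<noteq> 0"
    and nz: "\<And>n. s n \<noteq> 0"
    and s: "\<And>n. somos5_window \<alpha> \<beta> J s n"
    and diff: "\<And>x y. x \<in> R \<Longrightarrow> y \<in> R \<Longrightarrow> x - y \<in> R"
    and mult: "\<And>x y. x \<in> R \<Longrightarrow> y \<in> R \<Longrightarrow> x * y \<in> R"
    and R: "1 \<in> R" "\<alpha> \<in> R" "\<beta> \<in> R" "\<alpha> * J \<in> R"
    and init: "s 0 \<in> R" "s 1 \<in> R" "s 2 \<in> R" "s 3 \<in> R" "s 4 \<in> R"
    and inv: "inverse (s 0) \<in> R" "inverse (s 1) \<in> R"
  shows "s n \<in> R"
proof (induction n rule: less_induct)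
  case (less n)
  let ?a = "companion \<alpha> \<beta> J"
  have a: "?a m \<in> R" for m
    using companion_in_subring[OF anz diff mult R] .
  note addition = somos5_addition[OF nz s companion_window[OF anz] companion_init(1-5)]
  have step: "s (p+2*k+3) \<in> R" if "inverse (s p) \<in> R" "n = p+2*k+3" "k \<ge> 1" for p k
  proof -
    have "s (p+2*k+3) * s p \<in> R"
      unfolding addition by (intro diff mult a less) (use that in auto)
    hence "s (p+2*k+3) * s p * inverse (s p) \<in> R" using that mult by blast
    thus ?thesis using nz[of p] by (simp add: mult.assoc)
  qed
  show ?case
  proof (cases "n < 5")
    case True
    hence "n \<in> {0,1,2,3,4}" by auto
    thus ?thesis using init by auto
  next
    case False
    show ?thesis
    proof (cases "even n")
      case True
      then obtain k where "n = 2*k" by auto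
      thus ?thesis using False step[of 1 "k-2"] inv by (auto simp: algebra_simps)
    next
      case odd: False
      then obtain k where "n = 2*k+1" by (auto elim: oddE)
      thus ?thesis using False step[of 0 "k-1"] inv by (auto simp: algebra_simps eval_nat_numeral)
    qed
  qed
qed

section \<open>Values of rational functions\<close>

text \<open>
  A relational form of \<open>fract_value\<close>, which also records that the point lies in the domain of the
  function. The functions with a value form a ring, on which evaluation is a homomorphism.
\<close>

definition has_value :: "(nat \<Rightarrow> 'a::field) \<Rightarrow> int_mpoly fract \<Rightarrow> 'a \<Rightarrow> bool"
  where "has_value x f v \<longleftrightarrow>
    (\<exists>P Q. f = Fract P Q \<and> eval_mpoly x Q \<noteq> 0 \<and> v = eval_mpoly x P / eval_mpoly x Q)"

lemma has_value_fract_value: "has_value x f v \<Longrightarrow> fract_value x f = v"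
  by (auto simp: has_value_def fract_value_eqI)

lemma eval_mpoly_1: "eval_mpoly x 1 = 1"
  by (simp add: eval_mpoly_single eval_monom_def flip: single_one)

lemma eval_mpoly_uminus: "eval_mpoly x (- P) = - eval_mpoly x P"
  using eval_mpoly_add[of x "- P" P] by (simp add: eval_mpoly_0 eq_neg_iff_add_eq_0)

lemma has_value_indet: "has_value x (indet i) (x i)"
  unfolding has_value_def indet_def
  by (intro exI conjI, rule refl) (simp_all add: eval_mpoly_1 eval_mpoly_single eval_monom_def)

lemma has_value_0: "has_value x 0 0"
  unfolding has_value_def
  by (intro exI[of _ 0] exI[of _ 1]) (simp add: eval_mpoly_0 eval_mpoly_1 Zero_fract_def)

lemma has_value_1: "has_value x 1 1"
  unfolding has_value_def
  by (intro exI[of _ 1] exI[of _ 1]) (simp add: eval_mpoly_1 One_fract_def)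

lemma has_value_nonzero: "has_value x f v \<Longrightarrow> v \<noteq> 0 \<Longrightarrow> f \<noteq> 0"
  using has_value_fract_value[of x f v] has_value_fract_value[OF has_value_0, of x] by auto

lemma has_value_add:
  assumes "has_value x f v" "has_value x g w"
  shows "has_value x (f + g) (v + w)"
proof -
  obtain P Q P' Q' where *: "f = Fract P Q" "eval_mpoly x Q \<noteq> 0" "v = eval_mpoly x P / eval_mpoly x Q"
    "g = Fract P' Q'" "eval_mpoly x Q' \<noteq> 0" "w = eval_mpoly x P' / eval_mpoly x Q'"
    using assms unfolding has_value_def by blast
  moreover have "Q \<noteq> 0" "Q' \<noteq> 0" using * by (auto simp: eval_mpoly_0)
  ultimately show ?thesis unfolding has_value_def
    by (intro exI[of _ "P * Q' + P' * Q"] exI[of _ "Q * Q'"])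
      (simp add: eval_mpoly_add eval_mpoly_mult field_simps)
qed

lemma has_value_uminus: "has_value x f v \<Longrightarrow> has_value x (- f) (- v)"
  unfolding has_value_def by (fastforce simp: eval_mpoly_uminus intro: exI[of _ "- _"])

lemma has_value_mult:
  assumes "has_value x f v" "has_value x g w"
  shows "has_value x (f * g) (v * w)"
proof -
  obtain P Q P' Q' where *: "f = Fract P Q" "eval_mpoly x Q \<noteq> 0" "v = eval_mpoly x P / eval_mpoly x Q"
    "g = Fract P' Q'" "eval_mpoly x Q' \<noteq> 0" "w = eval_mpoly x P' / eval_mpoly x Q'"
    using assms unfolding has_value_def by blast
  show ?thesis unfolding has_value_def
    by (intro exI[of _ "P * P'"] exI[of _ "Q * Q'"]) (simp add: * eval_mpoly_mult)
qed

lemma has_value_inverse: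
  assumes "has_value x f v" "v \<noteq> 0"
  shows "has_value x (inverse f) (inverse v)"
proof -
  obtain P Q where *: "f = Fract P Q" "eval_mpoly x Q \<noteq> 0" "v = eval_mpoly x P / eval_mpoly x Q"
    using assms unfolding has_value_def by blast
  show ?thesis unfolding has_value_def
    by (intro exI[of _ Q] exI[of _ P]) (use * assms(2) in auto)
qed

lemma has_value_diff: "has_value x f v \<Longrightarrow> has_value x g w \<Longrightarrow> has_value x (f - g) (v - w)"
  using has_value_add[OF _ has_value_uminus, of x f v g w] by simp

lemma has_value_divide:
  "has_value x f v \<Longrightarrow> has_value x g w \<Longrightarrow> w \<noteq> 0 \<Longrightarrow> has_value x (f / g) (v / w)"
  using has_value_mult[OF _ has_value_inverse, of x f v g w] by (simp add: divide_inverse)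

lemma has_value_power: "has_value x f v \<Longrightarrow> has_value x (f ^ n) (v ^ n)"
  by (induction n) (auto intro: has_value_1 has_value_mult)

lemmas has_value_intros = has_value_add has_value_uminus has_value_mult has_value_diff
  has_value_divide has_value_power has_value_1 has_value_0

lemma has_value_somos5_J:
  assumes "has_value x a \<alpha>" "has_value x b \<beta>" "has_value x f1 t1" "has_value x f2 t2"
    "has_value x f3 t3" "has_value x f4 t4" "has_value x f5 t5"
    and "t1 \<noteq> 0" "t2 \<noteq> 0" "t3 \<noteq> 0" "t4 \<noteq> 0" "t5 \<noteq> 0"
  shows "has_value x (somos5_J a b f1 f2 f3 f4 f5) (somos5_J \<alpha> \<beta> t1 t2 t3 t4 t5)"
  unfolding somos5_J_def by (intro has_value_intros assms) (use assms in auto)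

section \<open>The formal sequence\<close>

definition formal_J :: "int_mpoly fract"
  where "formal_J = somos5_J (indet 6) (indet 7) (indet 1) (indet 2) (indet 3) (indet 4) (indet 5)"

text \<open>
  At this point \<open>\<alpha> = 3\<close>, \<open>\<beta> = -2\<close> and \<open>J = 6\<close>. Here \<open>\<alpha> + \<beta> = 1\<close> lets the Somos 5 sequence be constant,
  and the companion sequence is that of a cuspidal cubic, where the \<open>n\<close>-th division polynomial takes
  the value \<open>n\<close>; the normalization divides those of even index by the second one. Both sequences are thus explicit and visibly without zeros.
\<close>

definition degenerate_point :: "nat \<Rightarrow> rat"
  where "degenerate_point i = (if i = 6 then 3 else if i = 7 then -2 else 1)"

lemma has_value_degenerate_indet:
  "has_value degenerate_point (indet 6) 3" "has_value degenerate_point (indet 7) (-2)"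
  "i \<noteq> 6 \<Longrightarrow> i \<noteq> 7 \<Longrightarrow> has_value degenerate_point (indet i) 1"
  using has_value_indet[of degenerate_point 6] has_value_indet[of degenerate_point 7]
    has_value_indet[of degenerate_point i]
  by (simp_all add: degenerate_point_def)

lemma somos5_formal_degenerate: "has_value degenerate_point (somos5_formal n) 1"
proof (induction n rule: somos5_formal.induct)
  case (1 n)
  have *: "has_value degenerate_point ((indet 6 * f * g + indet 7 * h * k) / l) 1"
    if "has_value degenerate_point f 1" "has_value degenerate_point g 1"
      "has_value degenerate_point h 1" "has_value degenerate_point k 1"
      "has_value degenerate_point l 1" for f g h k l
  proof -
    have "has_value degenerate_point ((indet 6 * f * g + indet 7 * h * k) / l)
        ((3 * 1 * 1 + (-2) * 1 * 1) / 1)"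
      by (intro has_value_intros that has_value_degenerate_indet) auto
    thus ?thesis by simp
  qed
  consider "1 \<le> n \<and> n \<le> 5" | "5 < n" | "n < 1" by linarith
  thus ?case
  proof cases
    case a: 1
    thus ?thesis by (subst somos5_formal.simps) (auto intro!: has_value_degenerate_indet)
  next
    case 2
    thus ?thesis by (subst somos5_formal.simps) (auto intro!: * 1)
  next
    case 3
    thus ?thesis by (subst somos5_formal.simps) (auto intro!: * 1)
  qed
qed

lemma somos5_formal_nonzero: "somos5_formal n \<noteq> 0"
  using has_value_nonzero[OF somos5_formal_degenerate] by simp

lemma somos5_formal_init: "1 \<le> n \<Longrightarrow> n \<le> 5 \<Longrightarrow> somos5_formal n = indet (nat n)"
  by (simp add: somos5_formal.simps)

lemma somos5_formal_rec:
  "somos5_formal (n+5) * somos5_formal n =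
    indet 6 * somos5_formal (n+4) * somos5_formal (n+1)
    + indet 7 * somos5_formal (n+3) * somos5_formal (n+2)"
proof (cases "n \<ge> 1")
  case True
  thus ?thesis using somos5_formal_nonzero[of n]
    by (subst somos5_formal.simps) (simp add: ac_simps)
next
  case False
  have "somos5_formal n = (indet 6 * somos5_formal (n + 4) * somos5_formal (n + 1)
        + indet 7 * somos5_formal (n + 3) * somos5_formal (n + 2)) / somos5_formal (n + 5)"
    using False by (subst somos5_formal.simps) simp
  thus ?thesis using somos5_formal_nonzero[of "n+5"] by simp
qed

lemma companion_formal_degenerate:
  "has_value degenerate_point (companion (indet 6) (indet 7) formal_J n)
    (if even n then of_nat n / 2 else of_nat n)"
proof (induction n rule: less_induct)
  case (less n)
  let ?v = "has_value degenerate_point"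
  let ?a = "companion (indet 6) (indet 7) formal_J"
  have J: "?v formal_J 6"
  proof -
    have "?v formal_J (somos5_J 3 (-2) 1 1 1 1 1)"
      unfolding formal_J_def by (intro has_value_somos5_J has_value_degenerate_indet) auto
    thus ?thesis by (simp add: somos5_J_def)
  qed
  show ?case
  proof (cases "n < 6")
    case True
    have "?v (-(indet 7 * (indet 7 + indet 6 * formal_J) + indet 6 ^ 3)) (-((-2) * (-2 + 3 * 6) + 3 ^ 3))"
      by (intro has_value_intros J has_value_degenerate_indet)
    moreover have "?v (- indet 7) (- (-2))"
      by (intro has_value_intros has_value_degenerate_indet)
    moreover have "n \<in> {0,1,2,3,4,5}" using True by auto
    ultimately show ?thesis
      by (auto simp: companion_init companion_init_Suc has_value_0 has_value_1
          has_value_degenerate_indet simp del: minus_add_distrib)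
  next
    case False
    then obtain m where m: "n = m + 6" by (metis add.commute le_Suc_ex not_less)
    let ?w = "\<lambda>n. if even n then of_nat n / 2 else of_nat n :: rat"
    have "?v ((indet 6 * ?a (m+5) * ?a (m+2) + indet 7 * ?a (m+4) * ?a (m+3)) / ?a (m+1))
      ((3 * ?w (m+5) * ?w (m+2) + (-2) * ?w (m+4) * ?w (m+3)) / ?w (m+1))"
      by (intro has_value_intros has_value_degenerate_indet less) (auto simp: m add_eq_0_iff)
    moreover have "?a n = (indet 6 * ?a (m+5) * ?a (m+2) + indet 7 * ?a (m+4) * ?a (m+3)) / ?a (m+1)"
      by (subst companion.simps) (simp add: m eval_nat_numeral)
    moreover have "(3 * ?w (m+5) * ?w (m+2) + (-2) * ?w (m+4) * ?w (m+3)) / ?w (m+1) = ?w n"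
    proof -
      have "(of_nat m :: rat) + 1 \<noteq> 0" by (metis of_nat_Suc of_nat_eq_0_iff Suc_neq_Zero add.commute)
      thus ?thesis by (auto simp: m divide_simps) (auto simp: algebra_simps)
    qed
    ultimately show ?thesis by simp
  qed
qed

lemma companion_formal_nonzero: "companion (indet 6) (indet 7) formal_J (Suc n) \<noteq> 0"
  by (rule has_value_nonzero[OF companion_formal_degenerate]) (auto simp: add_eq_0_iff simp del: of_nat_Suc)

lemma somos5_formal_forward_window:
  "somos5_window (indet 6) (indet 7) formal_J (\<lambda>k. somos5_formal (int k + 1)) n"
proof (rule somos5_windowI)
  show "somos5_formal (int (n + 5) + 1) * somos5_formal (int n + 1) =
    indet 6 * somos5_formal (int (n + 4) + 1) * somos5_formal (int (n + 1) + 1)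
    + indet 7 * somos5_formal (int (n + 3) + 1) * somos5_formal (int (n + 2) + 1)" for n
    using somos5_formal_rec[of "int n + 1"] by (simp add: add_ac)
qed (simp_all add: somos5_formal_nonzero somos5_formal_init formal_J_def)

text \<open>
  The reversed sequence is started at \<open>somos5_formal 5\<close>, where reversal symmetry identifies its
  invariant with \<open>formal_J\<close>; the window condition is then moved three steps on.
\<close>

lemma somos5_formal_backward_window:
  "somos5_window (indet 6) (indet 7) formal_J (\<lambda>k. somos5_formal (2 - int k)) n"
proof -
  have "somos5_window (indet 6) (indet 7) formal_J (\<lambda>k. somos5_formal (5 - int k)) (n + 3)"
  proof (rule somos5_windowI)
    show "somos5_formal (5 - int (n + 5)) * somos5_formal (5 - int n) =
      indet 6 * somos5_formal (5 - int (n + 4)) * somos5_formal (5 - int (n + 1))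
      + indet 7 * somos5_formal (5 - int (n + 3)) * somos5_formal (5 - int (n + 2))" for n
    proof -
      have index: "5 - int (n + 5) = - int n" "5 - int n = - int n + 5"
        "5 - int (n + 4) = - int n + 1" "5 - int (n + 1) = - int n + 4"
        "5 - int (n + 3) = - int n + 2" "5 - int (n + 2) = - int n + 3"
        by simp_all
      show ?thesis unfolding index
        using somos5_formal_rec[of "- int n"] by (simp only: mult_ac)
    qed
  qed (simp_all add: somos5_formal_nonzero somos5_formal_init formal_J_def somos5_J_reverse)
  moreover have "5 - int (n + 3 + k) = 2 - int (n + k)" "5 - int (n + 3) = 2 - int n" for k
    by simp_all
  ultimately show ?thesis by (simp only: somos5_window_def)
qed

lemma has_value_somos5_formal_below:
  assumes "m < 1" "has_value x (somos5_formal (m+1)) v1" "has_value x (somos5_formal (m+2)) v2"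
    "has_value x (somos5_formal (m+3)) v3" "has_value x (somos5_formal (m+4)) v4"
    "has_value x (somos5_formal (m+5)) v5" "v5 \<noteq> 0"
  shows "\<exists>v. has_value x (somos5_formal m) v"
proof -
  have "somos5_formal m = (indet 6 * somos5_formal (m + 4) * somos5_formal (m + 1)
      + indet 7 * somos5_formal (m + 3) * somos5_formal (m + 2)) / somos5_formal (m + 5)"
    using assms(1) by (subst somos5_formal.simps) simp
  moreover have "has_value x \<dots> ((x 6 * v4 * v1 + x 7 * v3 * v2) / v5)"
    by (intro has_value_add has_value_mult has_value_divide has_value_indet assms)
  ultimately show ?thesis by auto
qed

theorem corollary3p8:
  fixes \<alpha> \<beta> t1 t2 t3 t4 t5 :: rat and \<tau> :: "int \<Rightarrow> rat"
  assumes "\<alpha> \<in> \<int>" "\<beta> \<in> \<int>"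
    and "t1 = 1 \<or> t1 = -1" "t2 = 1 \<or> t2 = -1"
    and "t3 \<in> \<int>" "t3 \<noteq> 0" "t4 \<in> \<int>" "t4 \<noteq> 0" "t5 \<in> \<int>" "t5 \<noteq> 0"
    and "\<tau> = somos5 \<alpha> \<beta> t1 t2 t3 t4 t5"
    and "\<alpha> * somos5_J \<alpha> \<beta> t1 t2 t3 t4 t5 \<in> \<int>"
  shows "(\<forall>n\<ge>1. \<tau> n \<in> \<int>) \<and>
    (\<tau> 0 \<in> \<int> \<and> \<tau> (-1) \<in> \<int> \<and> \<tau> (-2) \<in> \<int> \<longrightarrow> (\<forall>n. \<tau> n \<in> \<int>))"
proof -
  define x where "x = (\<lambda>i. [0, t1, t2, t3, t4, t5, \<alpha>, \<beta>] ! i)"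
  \<comment> \<open>Working in this ring replaces explicit Laurent polynomials: \<open>\<tau> n\<close> is an integer as soon as
    \<open>somos5_formal n\<close> lies in it.\<close>
  define R where "R = {f. \<exists>v\<in>\<int>. has_value x f v}"
  have RI: "has_value x f v \<Longrightarrow> v \<in> \<int> \<Longrightarrow> f \<in> R" for f v
    by (auto simp: R_def)
  have \<tau>: "has_value x (somos5_formal n) v \<Longrightarrow> \<tau> n = v" for n v
    using has_value_fract_value assms(11) by (simp add: somos5_def x_def)
  have \<tau>R: "somos5_formal n \<in> R \<Longrightarrow> \<tau> n \<in> \<int>" for n
    using \<tau> by (auto simp: R_def)
  have t0: "t1 \<noteq> 0" "t2 \<noteq> 0" using assms(3,4) by auto
  have tZ: "t1 \<in> \<int>" "t2 \<in> \<int>" "inverse t1 \<in> \<int>" "inverse t2 \<in> \<int>" using assms(3,4) by auto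
  have x: "has_value x (indet 1) t1" "has_value x (indet 2) t2" "has_value x (indet 3) t3"
    "has_value x (indet 4) t4" "has_value x (indet 5) t5" "has_value x (indet 6) \<alpha>"
    "has_value x (indet 7) \<beta>"
    using has_value_indet[of x 1] has_value_indet[of x 2] has_value_indet[of x 3]
      has_value_indet[of x 4] has_value_indet[of x 5] has_value_indet[of x 6] has_value_indet[of x 7]
    by (simp_all add: x_def)
  have diff: "f - g \<in> R" and mult: "f * g \<in> R" if "f \<in> R" "g \<in> R" for f g
    using that by (auto simp: R_def intro: has_value_diff has_value_mult)
  have R: "1 \<in> R" "indet 6 \<in> R" "indet 7 \<in> R" "indet 6 * formal_J \<in> R"
  proof -
    have "has_value x formal_J (somos5_J \<alpha> \<beta> t1 t2 t3 t4 t5)"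
      unfolding formal_J_def by (intro has_value_somos5_J x t0 assms)
    thus "indet 6 * formal_J \<in> R" using assms(12) by (blast intro: RI has_value_mult x)
  qed (use assms x in \<open>auto intro: RI has_value_1\<close>)
  have init: "indet 1 \<in> R" "indet 2 \<in> R" "indet 3 \<in> R" "indet 4 \<in> R" "indet 5 \<in> R"
    using x tZ assms by (auto intro: RI)
  have inv: "inverse (indet 1) \<in> R" "inverse (indet 2) \<in> R"
    using x t0 tZ by (auto intro: RI has_value_inverse)
  have forward: "somos5_formal (int k + 1) \<in> R" for k
    by (rule somos5_in_subring[OF companion_formal_nonzero _ somos5_formal_forward_window diff mult R])
      (use init inv in \<open>simp_all add: somos5_formal_nonzero somos5_formal_init\<close>)
  have pos: "\<tau> n \<in> \<int>" if "n \<ge> 1" for n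
    using \<tau>R[OF forward[of "nat (n - 1)"]] that by simp
  have "\<tau> n \<in> \<int>" if Z: "\<tau> 0 \<in> \<int>" "\<tau> (-1) \<in> \<int>" "\<tau> (-2) \<in> \<int>" for n
  proof (cases "n \<ge> 1")
    case False
    have xf: "has_value x (somos5_formal 1) t1" "has_value x (somos5_formal 2) t2"
      "has_value x (somos5_formal 3) t3" "has_value x (somos5_formal 4) t4"
      "has_value x (somos5_formal 5) t5"
      using x by (simp_all add: somos5_formal_init)
    \<comment> \<open>These terms are quotients by \<open>indet 5\<close>, \<open>indet 4\<close> and \<open>indet 3\<close>, so the point lies in
      their domains and an integral \<open>fract_value\<close> is a genuine value.\<close>
    obtain v0 where v0: "has_value x (somos5_formal 0) v0"
      using has_value_somos5_formal_below[of 0 x t1 t2 t3 t4 t5] xf assms by auto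
    obtain v1 where v1: "has_value x (somos5_formal (-1)) v1"
      using has_value_somos5_formal_below[of "-1" x v0 t1 t2 t3 t4] xf v0 assms by auto
    obtain v2 where v2: "has_value x (somos5_formal (-2)) v2"
      using has_value_somos5_formal_below[of "-2" x v1 v0 t1 t2 t3] xf v0 v1 assms by auto
    have backward: "somos5_formal 0 \<in> R" "somos5_formal (-1) \<in> R" "somos5_formal (-2) \<in> R"
      using RI[OF v0] RI[OF v1] RI[OF v2] Z \<tau>[OF v0] \<tau>[OF v1] \<tau>[OF v2] by simp_all
    have "somos5_formal (2 - int k) \<in> R" for k
      by (rule somos5_in_subring[OF companion_formal_nonzero _ somos5_formal_backward_window diff mult R])
        (use init inv backward in \<open>simp_all add: somos5_formal_nonzero somos5_formal_init\<close>)
    from \<tau>R[OF this[of "nat (2 - n)"]] False show ?thesis by simp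
  qed (use pos in auto)
  thus ?thesis using pos by blast
qed

end
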